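(* Let $X$ be a real Hilbert space of functions defined on a bounded domain $\Omega\subset\mathbb{R}^d$, let $\alpha_1,\dots,\alpha_n\in X$, $b_1,\dots,b_n\in\mathbb{R}$, and $$\mathcal{P}=\{x\in X\mid \langle\alpha_i,x\rangle_X\le b_i,\ i=1,\dots,n\}.$$ Let $V_\alpha=\operatorname{Span}\{\alpha_1,\dots,\alpha_n\}$, and let $\{y_i\}_{i=1}^p,\{z_i\}_{i=1}^q\subset V_\alpha$ be finite families such that $$\mathcal{P}=V_\alpha^\perp+\operatorname{conv}(\{y_i\}_{i=1}^p)+\operatorname{cone}(\{z_i\}_{i=1}^q).$$ Let $\{\hat\alpha_i\}_{i=1}^m$ be an orthonormal basis of $V_\alpha$. Let $g_1,\dots,g_p:\mathbb{R}^p\to\mathbb{R}$ and $h_1,\dots,h_q:\mathbb{R}\to\mathbb{R}$ be functions such that: (i) every $g_i$ and every $h_i$ is differentiable; (ii) the image of the mapping $(g_1,\dots,g_p):\mathbb{R}^p\to\mathbb{R}^p$ is a dense subset of the probability simplex $\mathcal{C}=\{(c_1,\dots,c_p)\in\mathbb{R}^p\mid c_i\ge0,\ i=1,\dots,p,\ \sum_{i=1}^pc_i=1\}$; (iii) for each $i=1,\dots,q$ the range of $h_i$ is a dense subset of $[0,\infty)$. Let $\mathcal{N}(\cdot,\theta)$ be a neural network with parameter $\theta$ such that $\mathcal{N}(\cdot,\theta)\in X$ for every $\theta$, and for $\hat\theta=(\theta,\{\lambda_i\}_{i=1}^p,\{\gamma_i\}_{i=1}^q)$ with $\lambda_i,\gamma_i\in\mathbb{R}$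 define $$U(\cdot,\hat\theta)=\mathcal{N}(\cdot,\theta)-\sum_{i=1}^m\langle\mathcal{N}(\cdot,\theta),\hat\alpha_i\rangle_X\,\hat\alpha_i+\sum_{i=1}^pg_i(\lambda_1,\dots,\lambda_p)\,y_i+\sum_{i=1}^qh_i(\gamma_i)\,z_i .$$ Then $U(\cdot,\hat\theta)\in\mathcal{P}$ for every $\hat\theta$. Moreover, if $\mathcal{N}(\cdot,\theta)$ is a universal approximator in $X$, then the family $\{U(\cdot,\hat\theta):\hat\theta\}$ is dense in $\mathcal{P}$ with respect to the norm $\|\cdot\|_X$.
   Context: For a subset $U$ of a real vector space, $\operatorname{conv}(U)$ is the set of all finite convex combinations of elements of $U$ and $\operatorname{cone}(U)$ the set of all finite linear combinations of elements of $U$ with nonnegative coefficients, with $\operatorname{cone}(\emptyset)=\{0\}$. Sums of sets are Minkowski sums, and $V_\alpha^\perp$ is the orthogonal complement in $X$. The neural network enters only as a parameterized family $\theta\mapsto\mathcal{N}(\cdot,\theta)\in X$, with $\theta$ ranging over a set of admissible parameters (possibly over networks of all sizes in the architecture). "$\mathcal{N}(\cdot,\theta)$ is a universal approximator in $X$" means that the set $\{\mathcal{N}(\cdot,\theta):\theta\}$ is dense in $X$ with respect to $\|\cdot\|_X$. *)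

theory Defs
  imports "HOL-Analysis.Analysis"
begin

definition bounded_domain :: "'a::real_normed_vector set \<Rightarrow> bool"
  where "bounded_domain \<Omega> \<longleftrightarrow> \<Omega> \<noteq> {} \<and> open \<Omega> \<and> connected \<Omega> \<and> bounded \<Omega>"

text \<open>
  The type \<open>'x\<close> as a vector space of functions on \<open>\<Omega>\<close> with values in \<open>'v\<close>: \<open>F\<close> is the vector space
  of functions that define an element of the space, and \<open>cls f\<close> is the element defined by \<open>f\<close>.
  Functions are total in HOL, so only the values on \<open>\<Omega>\<close> may matter. The map \<open>cls\<close> may
  identify functions that differ on \<open>\<Omega>\<close>; this covers spaces of equivalence classes such as
  \<open>L\<^sup>2(\<Omega>)\<close> (where \<open>cls f\<close> is the class of \<open>f\<close> modulo null sets) as well as spaces of genuine functions.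
\<close>

definition function_space_on ::
    "'a set \<Rightarrow> ('a \<Rightarrow> 'v::real_vector) set \<Rightarrow> (('a \<Rightarrow> 'v) \<Rightarrow> 'x::real_vector) \<Rightarrow> bool"
  where "function_space_on \<Omega> F cls \<longleftrightarrow>
    (\<forall>f\<in>F. \<forall>g\<in>F. (\<lambda>t. f t + g t) \<in> F \<and> cls (\<lambda>t. f t + g t) = cls f + cls g) \<and>
    (\<forall>c. \<forall>f\<in>F. (\<lambda>t. c *\<^sub>R f t) \<in> F \<and> cls (\<lambda>t. c *\<^sub>R f t) = c *\<^sub>R cls f) \<and>
    (\<forall>f\<in>F. \<forall>g. (\<forall>t\<in>\<Omega>. g t = f t) \<longrightarrow> g \<in> F \<and> cls g = cls f) \<and>
    cls ` F = UNIV"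

definition dense_subset :: "'a::topological_space set \<Rightarrow> 'a set \<Rightarrow> bool"
  where "dense_subset D S \<longleftrightarrow> D \<subseteq> S \<and> S \<subseteq> closure D"

definition prob_simplex :: "(real ^ 'p) set"
  where "prob_simplex = {c. (\<forall>i. 0 \<le> c $ i) \<and> (\<Sum>i\<in>UNIV. c $ i) = 1}"

definition orthonormal_basis :: "nat \<Rightarrow> (nat \<Rightarrow> 'x::real_inner) \<Rightarrow> 'x set \<Rightarrow> bool"
  where "orthonormal_basis m e V \<longleftrightarrow>
    (\<forall>i\<in>{1..m}. \<forall>j\<in>{1..m}. e i \<bullet> e j = (if i = j then 1 else 0)) \<and> span (e ` {1..m}) = V"

definition universal_approximator :: "'t set \<Rightarrow> ('t \<Rightarrow> 'x::topological_space) \<Rightarrow> bool"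
  where "universal_approximator \<Theta> N \<longleftrightarrow> dense_subset (N ` \<Theta>) UNIV"

text \<open>
  The set of all finite linear combinations with nonnegative coefficients is \<open>convex_cone hull\<close>;
  the library's \<open>cone hull\<close> is not closed under addition.
\<close>

lemma convex_cone_hull_explicit:
  fixes U :: "'a::real_vector set"
  shows "convex_cone hull U =
    {\<Sum>u\<in>S. c u *\<^sub>R u | S c. finite S \<and> S \<subseteq> U \<and> (\<forall>u\<in>S. 0 \<le> c u)}" (is "_ = ?C")
proof
  have *: "(\<Sum>u\<in>S. c u *\<^sub>R u) \<in> ?C" if "finite S" "S \<subseteq> U" "\<forall>u\<in>S. 0 \<le> c u" for S and c :: "'a \<Rightarrow> real"
    using that by blast
  show "convex_cone hull U \<subseteq> ?C"
  proof (rule hull_minimal)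
    show "U \<subseteq> ?C"
    proof
      fix u assume "u \<in> U"
      then show "u \<in> ?C" using *[of "{u}" "\<lambda>_. 1"] by simp
    qed
    show "convex_cone ?C"
      unfolding convex_cone_iff
    proof (intro conjI ballI allI impI)
      show "0 \<in> ?C" using *[of "{}"] by simp
    next
      fix x y assume "x \<in> ?C" "y \<in> ?C"
      then obtain S c T d where
        x: "x = (\<Sum>u\<in>S. c u *\<^sub>R u)" "finite S" "S \<subseteq> U" "\<forall>u\<in>S. 0 \<le> c u" and
        y: "y = (\<Sum>u\<in>T. d u *\<^sub>R u)" "finite T" "T \<subseteq> U" "\<forall>u\<in>T. (0::real) \<le> d u"
        by blast
      define c' where "c' u = (if u \<in> S then c u else 0)" for u
      define d' where "d' u = (if u \<in> T then d u else 0)" for u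
      have "x = (\<Sum>u\<in>S \<union> T. c' u *\<^sub>R u)" unfolding x(1) c'_def
        by (rule sum.mono_neutral_cong_left) (use x y in auto)
      moreover have "y = (\<Sum>u\<in>S \<union> T. d' u *\<^sub>R u)" unfolding y(1) d'_def
        by (rule sum.mono_neutral_cong_left) (use x y in auto)
      ultimately have "x + y = (\<Sum>u\<in>S \<union> T. (c' u + d' u) *\<^sub>R u)"
        by (simp add: scaleR_add_left sum.distrib)
      moreover have "\<forall>u\<in>S \<union> T. 0 \<le> c' u + d' u"
        using x(4) y(4) by (auto simp: c'_def d'_def)
      ultimately show "x + y \<in> ?C"
        using *[of "S \<union> T" "\<lambda>u. c' u + d' u"] x y by simp
    next
      fix x and a :: real assume "x \<in> ?C" "0 \<le> a"
      then obtain S c where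
        x: "x = (\<Sum>u\<in>S. c u *\<^sub>R u)" "finite S" "S \<subseteq> U" "\<forall>u\<in>S. 0 \<le> c u" by blast
      have "a *\<^sub>R x = (\<Sum>u\<in>S. (a * c u) *\<^sub>R u)" by (simp add: x(1) scaleR_sum_right)
      then show "a *\<^sub>R x \<in> ?C" using *[of S "\<lambda>u. a * c u"] x \<open>0 \<le> a\<close> by simp
    qed
  qed
  show "?C \<subseteq> convex_cone hull U"
  proof
    fix x assume "x \<in> ?C"
    then obtain S c where
      x: "x = (\<Sum>u\<in>S. c u *\<^sub>R u)" "finite S" "S \<subseteq> U" "\<forall>u\<in>S. 0 \<le> c u" by blast
    have cc: "convex_cone (convex_cone hull U)" by (rule convex_cone_convex_cone_hull)
    show "x \<in> convex_cone hull U" unfolding x(1) using x(2-4)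
    proof (induction S rule: finite_induct)
      case empty
      then show ?case by (simp add: convex_cone_contains_0[OF cc])
    next
      case (insert u S)
      then show ?case
        by (simp add: convex_cone_add[OF cc] convex_cone_scaleR[OF cc] hull_inc)
    qed
  qed
qed

end

theory Submission
  imports Defs
begin

text \<open>
  Subtracting the orthogonal projection onto \<open>V\<close> maps the whole space onto the complement of \<open>V\<close>, and
  each of the three summands of \<open>P\<close> is the image of a parameter set under a continuous map. A
  continuous map sends a dense set of parameters to a dense set of values, and a sum of dense subsets is
  dense in the Minkowski sum.
\<close>

lemma dense_subset_image:
  assumes "dense_subset D S" and "continuous_on UNIV f"
  shows "dense_subset (f ` D) (f ` S)"
proof -
  have "f ` closure D \<subseteq> closure (f ` D)"
    by (rule continuous_image_closure_subset[OF assms(2)]) simp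
  with assms(1) show ?thesis
    unfolding dense_subset_def by blast
qed

text \<open>Limits in the two summands can be taken separately because addition is continuous. This
  lets the three parts of \<open>P\<close> be approximated independently.\<close>

lemma dense_subset_plus:
  fixes A B S T :: "'a::real_normed_vector set"
  assumes "dense_subset A S" and "dense_subset B T"
  shows "dense_subset (A + B) (S + T)"
proof -
  have "S + T \<subseteq> closure A + closure B"
    using assms by (intro set_plus_mono2) (auto simp: dense_subset_def)
  also have "\<dots> \<subseteq> closure (A + B)"
    by (rule closure_sum)
  finally show ?thesis
    using assms by (simp add: dense_subset_def set_plus_mono2)
qed

text \<open>A linear image of the convex simplex is convex, and the vertices of the simplex are sent
  to the points \<open>y j\<close>; conversely every value is a convex combination of these points.
  Coefficients belong to indices rather than to points, so repetitions in \<open>y\<close> are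
  harmless and the coefficient vector has the form that the \<open>g i\<close> supply.\<close>

lemma convex_hull_range_eq_prob_simplex:
  fixes y :: "'p::finite \<Rightarrow> 'a::real_vector"
  shows "convex hull (range y) = (\<lambda>c. \<Sum>i\<in>UNIV. c $ i *\<^sub>R y i) ` prob_simplex"
    (is "_ = ?f ` _")
proof
  show "convex hull (range y) \<subseteq> ?f ` prob_simplex"
  proof (rule hull_minimal)
    show "range y \<subseteq> ?f ` prob_simplex"
    proof
      fix v assume "v \<in> range y"
      then obtain j where "v = y j" by blast
      then have "v = ?f (axis j 1)"
        by (simp add: axis_def if_distrib[of "\<lambda>a. a *\<^sub>R _"] cong: if_cong)
      moreover have "axis j 1 \<in> prob_simplex"
        by (simp add: prob_simplex_def axis_def)
      ultimately show "v \<in> ?f ` prob_simplex" by blast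
    qed
    have "linear ?f"
      by (rule linearI) (simp_all add: scaleR_add_left sum.distrib scaleR_sum_right)
    moreover have "convex (prob_simplex :: (real ^ 'p) set)"
      by (rule convexI) (auto simp: prob_simplex_def sum.distrib simp flip: sum_distrib_left)
    ultimately show "convex (?f ` prob_simplex)"
      by (rule convex_linear_image)
  qed
  show "?f ` prob_simplex \<subseteq> convex hull (range y)"
    by (auto simp: prob_simplex_def hull_inc intro!: convex_sum)
qed

text \<open>In \<open>convex_cone_hull_explicit\<close> coefficients are attached to vectors; here
  they are attached to indices, which fits the coefficients \<open>h i (c i)\<close> and allows
  repeated \<open>z i\<close>. For empty \<open>I\<close> both sides are \<open>{0}\<close>.\<close>

lemma convex_cone_hull_image_finite:
  fixes z :: "'i \<Rightarrow> 'a::real_vector"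
  assumes "finite I"
  shows "convex_cone hull (z ` I) = {\<Sum>i\<in>I. t i *\<^sub>R z i | t. \<forall>i\<in>I. 0 \<le> t i}" (is "_ = ?C")
proof
  have C: "(\<Sum>i\<in>I. t i *\<^sub>R z i) \<in> ?C" if "\<forall>i\<in>I. 0 \<le> t i" for t
    using that by blast
  show "convex_cone hull (z ` I) \<subseteq> ?C"
  proof (rule hull_minimal)
    show "z ` I \<subseteq> ?C"
    proof
      fix v assume "v \<in> z ` I"
      then obtain j where "j \<in> I" "v = z j" by blast
      then have "v = (\<Sum>i\<in>I. (if i = j then 1 else 0) *\<^sub>R z i)"
        using assms by (simp add: if_distrib[of "\<lambda>a. a *\<^sub>R _"] cong: if_cong)
      then show "v \<in> ?C"
        using C[of "\<lambda>i. if i = j then 1 else 0"] by simp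
    qed
    show "convex_cone ?C"
      unfolding convex_cone_iff
    proof (intro conjI ballI allI impI)
      show "0 \<in> ?C" using C[of "\<lambda>_. 0"] by simp
    next
      fix u v assume "u \<in> ?C" "v \<in> ?C"
      then obtain s t where "u = (\<Sum>i\<in>I. s i *\<^sub>R z i)" "\<forall>i\<in>I. 0 \<le> s i"
        and "v = (\<Sum>i\<in>I. t i *\<^sub>R z i)" "\<forall>i\<in>I. 0 \<le> t i" by blast
      then show "u + v \<in> ?C"
        using C[of "\<lambda>i. s i + t i"] by (simp add: scaleR_add_left sum.distrib)
    next
      fix u and a :: real assume "u \<in> ?C" "0 \<le> a"
      then obtain s where "u = (\<Sum>i\<in>I. s i *\<^sub>R z i)" "\<forall>i\<in>I. 0 \<le> s i" by blast
      then show "a *\<^sub>R u \<in> ?C"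
        using C[of "\<lambda>i. a * s i"] \<open>0 \<le> a\<close> by (simp add: scaleR_sum_right)
    qed
  qed
  \<comment> \<open>Generalising to \<open>J \<subseteq> I\<close> lets the induction add one
    generator at a time while the target cone and the condition on \<open>t\<close> stay
    fixed.\<close>
  have "(\<Sum>i\<in>J. t i *\<^sub>R z i) \<in> convex_cone hull (z ` I)"
    if "finite J" "J \<subseteq> I" "\<forall>i\<in>I. 0 \<le> t i" for t J
    using that
    by (induction J)
      (simp_all add: convex_cone_hull_contains_0 convex_cone_hull_add convex_cone_hull_mul hull_inc)
  with assms show "?C \<subseteq> convex_cone hull (z ` I)" by blast
qed

text \<open>Picking a preimage of every term turns a sequence of values into a sequence of
  parameters, and such sequences can be combined across coordinates.\<close>

lemma closure_range_sequential:
  fixes f :: "'s \<Rightarrow> 'a::first_countable_topology"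
  assumes "a \<in> closure (range f)"
  shows "\<exists>s. (\<lambda>k. f (s k)) \<longlonglongrightarrow> a"
proof -
  obtain x where x: "\<forall>k. x k \<in> range f" "x \<longlonglongrightarrow> a"
    using assms unfolding closure_sequential by blast
  then obtain s where "\<forall>k. x k = f (s k)"
    unfolding image_iff by metis
  then have "x = (\<lambda>k. f (s k))" by blast
  with x(2) show ?thesis by blast
qed

text \<open>Each generator has a parameter of its own, so the coefficients can be approximated one
  by one, and their convergence carries over to the sum.\<close>

lemma dense_subset_nonneg_combinations:
  fixes z :: "'i \<Rightarrow> 'a::real_normed_vector" and h :: "'i \<Rightarrow> 's \<Rightarrow> real"
  assumes "\<forall>i\<in>I. dense_subset (range (h i)) {0..}"
  shows "dense_subset (range (\<lambda>c. \<Sum>i\<in>I. h i (c i) *\<^sub>R z i))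
    {\<Sum>i\<in>I. t i *\<^sub>R z i | t. \<forall>i\<in>I. 0 \<le> t i}" (is "dense_subset ?D ?C")
  unfolding dense_subset_def
proof
  have "0 \<le> h i s" if "i \<in> I" for i s
    using assms that by (auto simp: dense_subset_def)
  then have "(\<Sum>i\<in>I. h i (c i) *\<^sub>R z i) \<in> ?C" for c
    by (intro CollectI exI[of _ "\<lambda>i. h i (c i)"]) simp
  then show "?D \<subseteq> ?C" by blast
  show "?C \<subseteq> closure ?D"
  proof
    fix v assume "v \<in> ?C"
    then obtain t where v: "v = (\<Sum>i\<in>I. t i *\<^sub>R z i)" and "\<forall>i\<in>I. 0 \<le> t i" by blast
    with assms have "\<forall>i\<in>I. t i \<in> closure (range (h i))"
      by (auto simp: dense_subset_def)
    then have "\<forall>i\<in>I. \<exists>s. (\<lambda>k. h i (s k)) \<longlonglongrightarrow> t i"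
      by (blast intro: closure_range_sequential)
    \<comment> \<open>The sequences are chosen for all \<open>i\<close> at once: at stage
      \<open>k\<close> the function \<open>\<lambda>i. s i k\<close> is a single admissible
      parameter \<open>c\<close>.\<close>
    then obtain s where "\<forall>i\<in>I. (\<lambda>k. h i (s i k)) \<longlonglongrightarrow> t i" by metis
    then have "(\<lambda>k. \<Sum>i\<in>I. h i (s i k) *\<^sub>R z i) \<longlonglongrightarrow> v"
      unfolding v by (auto intro!: tendsto_intros)
    then show "v \<in> closure ?D"
      unfolding closure_sequential by (intro exI[of _ "\<lambda>k. \<Sum>i\<in>I. h i (s i k) *\<^sub>R z i"]) auto
  qed
qed

text \<open>A residual is orthogonal to each basis vector, hence to their span, and a vector of
  \<open>V\<^sup>\<bottom>\<close> is its own residual. The inclusion from left to right serves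
  membership in \<open>P\<close>, surjectivity serves density.\<close>

lemma orthonormal_basis_residual_range:
  fixes e :: "nat \<Rightarrow> 'a::real_inner"
  assumes "orthonormal_basis m e V"
  shows "range (\<lambda>x. x - (\<Sum>i=1..m. (x \<bullet> e i) *\<^sub>R e i)) = V\<^sup>\<bottom>" (is "range ?R = _")
proof
  have e: "e i \<bullet> e j = (if i = j then 1 else 0)" if "i \<in> {1..m}" "j \<in> {1..m}" for i j
    using assms that by (auto simp: orthonormal_basis_def)
  have V: "V = span (e ` {1..m})"
    using assms by (simp add: orthonormal_basis_def)
  show "range ?R \<subseteq> V\<^sup>\<bottom>"
  proof (rule image_subsetI)
    fix x
    have "(\<Sum>i=1..m. (x \<bullet> e i) * (e i \<bullet> e j)) = x \<bullet> e j" if j: "j \<in> {1..m}" for j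
    proof -
      \<comment> \<open>Orthonormality leaves only the term with \<open>i = j\<close>.\<close>
      have "(\<Sum>i=1..m. (x \<bullet> e i) * (e i \<bullet> e j)) = (\<Sum>i=1..m. if i = j then x \<bullet> e i else 0)"
        using e j by (intro sum.cong) auto
      with j show ?thesis by simp
    qed
    then have *: "orthogonal (?R x) (e j)" if "j \<in> {1..m}" for j
      using that by (simp add: orthogonal_def inner_diff_left inner_sum_left)
    have "orthogonal (?R x) v" if "v \<in> V" for v
      by (rule orthogonal_to_span[of _ "e ` {1..m}"]) (use that V * in auto)
    then show "?R x \<in> V\<^sup>\<bottom>"
      by (simp add: orthogonal_comp_def orthogonal_commute)
  qed
  show "V\<^sup>\<bottom> \<subseteq> range ?R"
  proof
    fix x assume "x \<in> V\<^sup>\<bottom>"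
    then have "\<forall>i\<in>{1..m}. x \<bullet> e i = 0"
      by (auto simp: orthogonal_comp_def orthogonal_def inner_commute V span_base)
    then have "x = ?R x" by simp
    then show "x \<in> range ?R" by (rule range_eqI)
  qed
qed

theorem lemma2p2:
  fixes \<Omega> :: "(real ^ 'd) set"
    and F :: "(real ^ 'd \<Rightarrow> 'v::real_vector) set"
    and cls :: "(real ^ 'd \<Rightarrow> 'v) \<Rightarrow> 'x::{real_inner, complete_space}"
    and n m q :: nat
    and \<alpha> :: "nat \<Rightarrow> 'x" and b :: "nat \<Rightarrow> real"
    and P V :: "'x set"
    and y :: "'p::finite \<Rightarrow> 'x" and z :: "nat \<Rightarrow> 'x"
    and \<alpha>h :: "nat \<Rightarrow> 'x"
    and g :: "'p \<Rightarrow> real ^ 'p \<Rightarrow> real" and h :: "nat \<Rightarrow> real \<Rightarrow> real"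
    and \<Theta> :: "'t set" and N :: "'t \<Rightarrow> real ^ 'd \<Rightarrow> 'v"
    and U :: "'t \<Rightarrow> real ^ 'p \<Rightarrow> (nat \<Rightarrow> real) \<Rightarrow> 'x"
  assumes "bounded_domain \<Omega>" and "function_space_on \<Omega> F cls"
    and P_def: "P = {x. \<forall>i\<in>{1..n}. \<alpha> i \<bullet> x \<le> b i}"
    and V_def: "V = span (\<alpha> ` {1..n})"
    and "range y \<subseteq> V" and "z ` {1..q} \<subseteq> V"
    and "P = V\<^sup>\<bottom> + convex hull (range y) + convex_cone hull (z ` {1..q})"
    and "orthonormal_basis m \<alpha>h V"
    and "\<forall>i x. g i differentiable (at x)"
    and "\<forall>i\<in>{1..q}. \<forall>t. h i differentiable (at t)"
    and "dense_subset (range (\<lambda>l. \<chi> i. g i l)) prob_simplex"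
    and "\<forall>i\<in>{1..q}. dense_subset (range (h i)) {0..}"
    and "\<forall>\<theta>\<in>\<Theta>. N \<theta> \<in> F"
    and U_def: "\<And>\<theta> l c. U \<theta> l c =
      cls (N \<theta>) - (\<Sum>i=1..m. (cls (N \<theta>) \<bullet> \<alpha>h i) *\<^sub>R \<alpha>h i)
        + (\<Sum>i\<in>UNIV. g i l *\<^sub>R y i) + (\<Sum>i=1..q. h i (c i) *\<^sub>R z i)"
  shows "(\<forall>\<theta>\<in>\<Theta>. \<forall>l c. U \<theta> l c \<in> P) \<and>
    (universal_approximator \<Theta> (\<lambda>\<theta>. cls (N \<theta>)) \<longrightarrow>
      dense_subset {U \<theta> l c | \<theta> l c. \<theta> \<in> \<Theta>} P)"
proof
  let ?R = "\<lambda>x. x - (\<Sum>i=1..m. (x \<bullet> \<alpha>h i) *\<^sub>R \<alpha>h i)"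
  let ?Y = "\<lambda>c. \<Sum>i\<in>UNIV. c $ i *\<^sub>R y i"
  \<comment> \<open>The factor through the simplex is kept visible, so that density of the image of
    the \<open>g i\<close> can be pushed through the continuous map \<open>?Y\<close>.\<close>
  let ?B = "?Y ` range (\<lambda>l. \<chi> i. g i l)"
  let ?C = "range (\<lambda>c. \<Sum>i=1..q. h i (c i) *\<^sub>R z i)"
  note P = assms(7) and R = orthonormal_basis_residual_range[OF assms(8)]
  have B: "dense_subset ?B (convex hull (range y))"
    unfolding convex_hull_range_eq_prob_simplex
    by (intro dense_subset_image assms(11) continuous_intros)
  have C: "dense_subset ?C (convex_cone hull (z ` {1..q}))"
    unfolding convex_cone_hull_image_finite[OF finite_atLeastAtMost]
    by (rule dense_subset_nonneg_combinations[OF assms(12)])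
  \<comment> \<open>Since \<open>\<theta>\<close>, \<open>l\<close> and \<open>c\<close> vary
    independently, the family is the full Minkowski sum of the three images.\<close>
  have U: "{U \<theta> l c | \<theta> l c. \<theta> \<in> \<Theta>} = ?R ` (\<lambda>\<theta>. cls (N \<theta>)) ` \<Theta> + ?B + ?C"
    unfolding U_def set_plus_def by simp blast
  show "\<forall>\<theta>\<in>\<Theta>. \<forall>l c. U \<theta> l c \<in> P"
  proof -
    have "?R ` (\<lambda>\<theta>. cls (N \<theta>)) ` \<Theta> \<subseteq> V\<^sup>\<bottom>"
      using R by blast
    \<comment> \<open>Density in a set includes containment in it, so \<open>B\<close> and
      \<open>C\<close> also place the last two summands.\<close>
    with B C have "?R ` (\<lambda>\<theta>. cls (N \<theta>)) ` \<Theta> + ?B + ?C \<subseteq> P"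
      unfolding P dense_subset_def by (intro set_plus_mono2) auto
    then show ?thesis
      unfolding U[symmetric] by blast
  qed
  show "universal_approximator \<Theta> (\<lambda>\<theta>. cls (N \<theta>)) \<longrightarrow>
      dense_subset {U \<theta> l c | \<theta> l c. \<theta> \<in> \<Theta>} P"
  proof
    assume "universal_approximator \<Theta> (\<lambda>\<theta>. cls (N \<theta>))"
    \<comment> \<open>Reading \<open>V\<^sup>\<bottom>\<close> as the image of the whole space under
      the continuous map \<open>?R\<close> transfers density of the networks.\<close>
    then have "dense_subset (?R ` (\<lambda>\<theta>. cls (N \<theta>)) ` \<Theta>) (V\<^sup>\<bottom>)"
      unfolding R[symmetric] universal_approximator_def
      by (intro dense_subset_image continuous_intros)
    with B C show "dense_subset {U \<theta> l c | \<theta> l c. \<theta> \<in> \<Theta>} P"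
      unfolding U P by (intro dense_subset_plus)
  qed
qed

end
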